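(* Let $X_1,\dots,X_n$ be finite non-empty subsets of the unit sphere $S^{d-1}\subset\mathbb{R}^d$, where $X_i$ is a spherical $t_i$-design for each $i\in\{1,\dots,n\}$. Assume that for all $i,j\in\{1,\dots,n\}$ we have ($X_i\cap X_j=\emptyset$ or $X_i=X_j$) and ($X_i\cap(-X_j)=\emptyset$ or $X_i=-X_j$). Put $$A(X_i,X_j)=\{\langle x,y\rangle\mid x\in X_i,\ y\in X_j,\ x\neq\pm y\},\qquad A'(X_i,X_j)=\{\langle x,y\rangle\mid x\in X_i,\ y\in X_j,\ x\neq y\},$$ $s_{i,j}=|A(X_i,X_j)|$, $s_{i,j}^*=|A'(X_i,X_j)|$. Write $A(X_i,X_j)=\{\alpha_{i,j}^1,\dots,\alpha_{i,j}^{s_{i,j}}\}$, put $\alpha_{i,j}^0=1$, and, when $-1\in A'(X_i,X_j)$, put $\alpha_{i,j}^{s_{i,j}^*}=-1$. Define $R_{i,j}^k=\{(x,y)\in X_i\times X_j\mid\langle x,y\rangle=\alpha_{i,j}^k\}$. For $x,y\in S^{d-1}$ let $$p_{\alpha,\beta}^j(x,y)=|\{z\in X_j\mid\langle x,z\rangle=\alpha,\ \langle y,z\rangle=\beta\}|.$$ Suppose that for every choice of $i,j,k\in\{1,\dots,n\}$ one of the following holds (which one may depend on $i,j,k$): (1) $s_{i,j}+s_{j,k}-2\le t_j$; (2) $s_{i,j}+s_{j,k}-3=t_j$, and for any $\gamma\in A(X_i,X_k)$ there exist $\alpha\in A(X_i,X_j)$, $\beta\in A(X_j,X_k)$ such that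 the number $p_{\alpha,\beta}^j(x,y)$ is independent of the choice of $x\in X_i$, $y\in X_k$ with $\gamma=\langle x,y\rangle$; (3) $s_{i,j}+s_{j,k}-4=t_j$, and for any $\gamma\in A(X_i,X_k)$ there exist $\alpha,\alpha'\in A(X_i,X_j)$, $\beta,\beta'\in A(X_j,X_k)$ such that $\alpha\neq\alpha'$, $\beta\neq\beta'$ and the numbers $p_{\alpha,\beta}^j(x,y)$, $p_{\alpha,\beta'}^j(x,y)$ and $p_{\alpha',\beta}^j(x,y)$ are independent of the choice of $x\in X_i$, $y\in X_k$ with $\gamma=\langle x,y\rangle$. Then $$\Big(\coprod_{i=1}^nX_i,\ \{R_{i,j}^k\mid 1\le i,j\le n,\ 1-\delta_{X_i,X_j}\le k\le s_{i,j}^*\}\Big)$$ is a coherent configuration. Moreover, the parameters of this coherent configuration are determined by the $A(X_i,X_j)$, $|X_i|$, $t_i$, $\delta_{X_i,X_j}$, $\delta_{X_i,-X_j}$, and, when $s_{i,j}+s_{j,k}-3=t_j$ (resp. $s_{i,j}+s_{j,k}-4=t_j$), the numbers $p_{\alpha,\beta}^j(x,y)$ (resp. $p_{\alpha,\beta}^j(x,y)$, $p_{\alpha',\beta}^j(x,y)$, $p_{\alpha,\beta'}^j(x,y)$) which are assumed to be independent of $(x,y)$ with $\langle x,y\rangle=\gamma$.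
   Context: $\langle\cdot,\cdot\rangle$ is the standard inner product on $\mathbb{R}^d$. For a positive integer $t$, a finite non-empty set $X\subset S^{d-1}$ is a spherical $t$-design if $\frac{1}{|X|}\sum_{x\in X}f(x)=\frac{1}{|S^{d-1}|}\int_{S^{d-1}}f\,d\sigma$ for all real polynomials $f$ in $d$ variables of degree at most $t$, where $|S^{d-1}|$ is the volume of the sphere. $\coprod$ denotes disjoint union: when $X_i=X_j$ with $i\ne j$, the two sets are treated as distinct copies. $\delta_{A,B}$ equals $1$ if $A=B$ and $0$ otherwise; $-X=\{-x\mid x\in X\}$. Coherent configuration: for a finite set $X$ and a family $\{f_i\}_{i\in I}$ of relations on $X$, put $f_i^t=\{(y,x)\mid(x,y)\in f_i\}$ and $\mathrm{diag}(X\times X)=\{(x,x)\mid x\in X\}$. The pair $(X,\{f_i\}_{i\in I})$ is a coherent configuration if (a) $\{f_i\}_{i\in I}$ is a partition of $X\times X$; (b) for each $i$, $f_i^t=f_{i^*}$ for some $i^*\in I$; (c) $f_i\cap\mathrm{diag}(X\times X)\ne\emptyset$ implies $f_i\subset\mathrm{diag}(X\times X)$; (d) for $i,j,k\in I$ the number $|\{z\in X\mid(x,z)\in f_i,(z,y)\in f_j\}|$ is independent of the choice of $(x,y)\in f_k$. The numbers in (d) are the parameters (intersection numbers) of the configuration. *)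

theory Defs
  imports "HOL-Analysis.Analysis"
begin

section \<open>Spherical designs\<close>

text \<open>
  The surface measure of the unit sphere, in the polar-coordinate normalisation: the measure of a
  Borel set \<open>E\<close> is \<open>d\<close> times the Lebesgue measure of the cone of all \<open>r *\<^sub>R e\<close> with \<open>0 < r < 1\<close> and
  \<open>e \<in> E\<close> (recall that \<open>sgn x = x /\<^sub>R norm x\<close>). For \<open>d = 1\<close> this is the counting measure
  on the two unit vectors.
\<close>

definition sphere_measure :: "(real ^ 'd) measure" where
  "sphere_measure = scale_measure (of_nat CARD('d))
     (distr (restrict_space lborel (ball 0 1 - {0})) (restrict_space borel (sphere 0 1)) sgn)"

lemma space_sphere_measure [simp]: "space sphere_measure = sphere 0 1"
  by (simp add: sphere_measure_def space_scale_measure space_restrict_space)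

lemma measurable_sgn_sphere:
  "sgn \<in> restrict_space lborel (ball 0 1 - {0 :: real ^ 'd}) \<rightarrow>\<^sub>M restrict_space borel (sphere 0 1)"
proof (rule measurable_restrict_space2)
  show "sgn \<in> space (restrict_space lborel (ball 0 1 - {0 :: real ^ 'd})) \<rightarrow> sphere 0 1"
    by (auto simp: space_restrict_space norm_sgn)
  have "continuous_on (ball 0 1 - {0 :: real ^ 'd}) sgn"
    unfolding sgn_div_norm by (intro continuous_intros) auto
  then show "sgn \<in> restrict_space lborel (ball 0 1 - {0 :: real ^ 'd}) \<rightarrow>\<^sub>M borel"
    using borel_measurable_continuous_on_restrict
      measurable_cong_sets sets_restrict_space_cong[OF sets_lborel] by blast
qed

text \<open>The total mass is the classical area of the sphere: \<open>2\<close>, \<open>2 * pi\<close>, \<open>4 * pi\<close>, \<dots>\<close>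

lemma measure_sphere_measure:
  "measure (sphere_measure :: (real ^ 'd) measure) (sphere 0 1)
     = real CARD('d) * unit_ball_vol (real CARD('d))"
proof -
  let ?B = "ball 0 1 - {0 :: real ^ 'd}"
  have sph: "sphere 0 1 \<in> sets (restrict_space borel (sphere (0 :: real ^ 'd) 1))"
    by (simp add: sets_restrict_space_iff)
  have "sgn -` sphere 0 1 \<inter> space (restrict_space lborel ?B) = ?B"
    by (auto simp: space_restrict_space norm_sgn)
  then have "measure (distr (restrict_space lborel ?B) (restrict_space borel (sphere 0 1)) sgn)
      (sphere 0 1) = measure (restrict_space lborel ?B) ?B"
    using measure_distr[OF measurable_sgn_sphere sph] by simp
  also have "\<dots> = measure lborel ?B"
    by (subst measure_restrict_space) auto
  also have "\<dots> = measure lborel (ball (0 :: real ^ 'd) 1)"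
    by (rule measure_Diff_null_set) auto
  also have "\<dots> = unit_ball_vol (real CARD('d))"
    using content_ball[of 1 "0 :: real ^ 'd"] by simp
  finally show ?thesis
    by (simp add: sphere_measure_def measure_def enn2real_mult)
qed

text \<open>
  The real polynomial function in \<open>d\<close> variables of degree at most \<open>t\<close> with coefficient \<open>c a\<close> at the
  monomial with exponent vector \<open>a\<close>.
\<close>

definition poly_fun :: "nat \<Rightarrow> (('d::finite \<Rightarrow> nat) \<Rightarrow> real) \<Rightarrow> real ^ 'd \<Rightarrow> real" where
  "poly_fun t c x = (\<Sum>a | (\<Sum>i\<in>UNIV. a i) \<le> t. c a * (\<Prod>i\<in>UNIV. (x $ i) ^ a i))"

lemma finite_exponents: "finite {a :: 'd::finite \<Rightarrow> nat. (\<Sum>i\<in>UNIV. a i) \<le> t}"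
proof (rule finite_subset)
  show "{a :: 'd \<Rightarrow> nat. (\<Sum>i\<in>UNIV. a i) \<le> t} \<subseteq> (\<Pi>\<^sub>E i\<in>UNIV. {..t})"
    by (auto intro: order_trans[OF member_le_sum[of _ UNIV]])
  show "finite (\<Pi>\<^sub>E i\<in>(UNIV :: 'd set). {..t})"
    by (intro finite_PiE) auto
qed

definition spherical_design :: "nat \<Rightarrow> (real ^ 'd) set \<Rightarrow> bool" where
  "spherical_design t X \<longleftrightarrow> 0 < t \<and> finite X \<and> X \<noteq> {} \<and> X \<subseteq> sphere 0 1 \<and>
     (\<forall>c. (\<Sum>x\<in>X. poly_fun t c x) / real (card X)
        = integral\<^sup>L sphere_measure (poly_fun t c) /
            measure (sphere_measure :: (real ^ 'd) measure) (sphere 0 1))"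


section \<open>Coherent configurations\<close>

text \<open>
  Since the family \<open>f\<close> is indexed by \<open>I\<close>, injectivity of the indexing is part of the
  partition condition.
\<close>

definition coherent_configuration :: "'a set \<Rightarrow> 'i set \<Rightarrow> ('i \<Rightarrow> ('a \<times> 'a) set) \<Rightarrow> bool" where
  "coherent_configuration X I f \<longleftrightarrow> finite X \<and>
     (partition_on (X \<times> X) (f ` I) \<and> inj_on f I) \<and>
     (\<forall>i\<in>I. \<exists>i'\<in>I. (f i)\<inverse> = f i') \<and>
     (\<forall>i\<in>I. f i \<inter> Id_on X \<noteq> {} \<longrightarrow> f i \<subseteq> Id_on X) \<and>
     (\<forall>i\<in>I. \<forall>j\<in>I. \<forall>k\<in>I. \<exists>p. \<forall>(x, y)\<in>f k. card {z\<in>X. (x, z) \<in> f i \<and> (z, y) \<in> f j} = p)"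

text \<open>
  In a coherent configuration \<open>f k\<close> is nonempty, so the description below is uniquely satisfied.
\<close>

definition intersection_number ::
    "'a set \<Rightarrow> ('i \<Rightarrow> ('a \<times> 'a) set) \<Rightarrow> 'i \<Rightarrow> 'i \<Rightarrow> 'i \<Rightarrow> nat" where
  "intersection_number X f i j k =
     (THE p. \<forall>(x, y)\<in>f k. card {z\<in>X. (x, z) \<in> f i \<and> (z, y) \<in> f j} = p)"


section \<open>Families of designs\<close>

text \<open>\<open>angles X Y\<close> and \<open>angles' X Y\<close> are the sets \<open>A(X, Y)\<close> and \<open>A'(X, Y)\<close>.\<close>

definition angles :: "(real ^ 'd) set \<Rightarrow> (real ^ 'd) set \<Rightarrow> real set" where
  "angles X Y = {x \<bullet> y | x y. x \<in> X \<and> y \<in> Y \<and> x \<noteq> y \<and> x \<noteq> - y}"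

definition angles' :: "(real ^ 'd) set \<Rightarrow> (real ^ 'd) set \<Rightarrow> real set" where
  "angles' X Y = {x \<bullet> y | x y. x \<in> X \<and> y \<in> Y \<and> x \<noteq> y}"

definition num_angles :: "(nat \<Rightarrow> (real ^ 'd) set) \<Rightarrow> nat \<Rightarrow> nat \<Rightarrow> nat" where
  "num_angles X i j = card (angles (X i) (X j))"

definition design_family :: "nat \<Rightarrow> (nat \<Rightarrow> nat) \<Rightarrow> (nat \<Rightarrow> (real ^ 'd) set) \<Rightarrow> bool" where
  "design_family n t X \<longleftrightarrow>
     (\<forall>i\<in>{1..n}. finite (X i) \<and> X i \<noteq> {} \<and> X i \<subseteq> sphere 0 1 \<and> spherical_design (t i) (X i)) \<and>
     (\<forall>i\<in>{1..n}. \<forall>j\<in>{1..n}. (X i \<inter> X j = {} \<or> X i = X j) \<and>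
        (X i \<inter> uminus ` X j = {} \<or> X i = uminus ` X j))"

text \<open>
  \<open>\<alpha> i j\<close> enumerates \<open>A(X i, X j)\<close> by the indices \<open>1, \<dots>, s i j\<close>; index \<open>0\<close> is reserved for the inner
  product \<open>1\<close>, and index \<open>s* i j = s i j + 1\<close> for the inner product \<open>-1\<close> when it occurs.
\<close>

definition angle_enumeration ::
    "nat \<Rightarrow> (nat \<Rightarrow> (real ^ 'd) set) \<Rightarrow> (nat \<Rightarrow> nat \<Rightarrow> nat \<Rightarrow> real) \<Rightarrow> bool" where
  "angle_enumeration n X \<alpha> \<longleftrightarrow> (\<forall>i\<in>{1..n}. \<forall>j\<in>{1..n}.
     bij_betw (\<alpha> i j) {1..num_angles X i j} (angles (X i) (X j)) \<and>
     \<alpha> i j 0 = 1 \<and>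
     (- 1 \<in> angles' (X i) (X j) \<longrightarrow> \<alpha> i j (card (angles' (X i) (X j))) = - 1))"

text \<open>
  The disjoint union of the \<open>X i\<close>, the relations \<open>R i j k\<close> on it, and their index set. For
  \<open>i \<noteq> j\<close> with \<open>X i = X j\<close> the relation \<open>R i j 0\<close> is the matching between the two copies; it is not
  contained in the diagonal of the disjoint union.
\<close>

definition points :: "nat \<Rightarrow> (nat \<Rightarrow> (real ^ 'd) set) \<Rightarrow> (nat \<times> (real ^ 'd)) set" where
  "points n X = (SIGMA i:{1..n}. X i)"

definition rels :: "(nat \<Rightarrow> (real ^ 'd) set) \<Rightarrow> (nat \<Rightarrow> nat \<Rightarrow> nat \<Rightarrow> real) \<Rightarrow>
    nat \<times> nat \<times> nat \<Rightarrow> ((nat \<times> (real ^ 'd)) \<times> (nat \<times> (real ^ 'd))) set" where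
  "rels X \<alpha> = (\<lambda>(i, j, k). {((i, x), (j, y)) | x y. x \<in> X i \<and> y \<in> X j \<and> x \<bullet> y = \<alpha> i j k})"

definition rel_indices :: "nat \<Rightarrow> (nat \<Rightarrow> (real ^ 'd) set) \<Rightarrow> (nat \<times> nat \<times> nat) set" where
  "rel_indices n X = {(i, j, k). i \<in> {1..n} \<and> j \<in> {1..n} \<and>
     1 - of_bool (X i = X j) \<le> k \<and> k \<le> card (angles' (X i) (X j))}"

text \<open>\<open>pnum (X j) a b x y\<close> is the number \<open>p\<close> with indices \<open>a, b\<close> and superscript \<open>j\<close> at \<open>(x, y)\<close>.\<close>

definition pnum :: "(real ^ 'd) set \<Rightarrow> real \<Rightarrow> real \<Rightarrow> real ^ 'd \<Rightarrow> real ^ 'd \<Rightarrow> nat" where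
  "pnum Z a b x y = card {z\<in>Z. x \<bullet> z = a \<and> y \<bullet> z = b}"

text \<open>\<open>p\<close> takes the constant value \<open>q\<close> on the pairs in \<open>X \<times> Y\<close> with inner product \<open>\<gamma>\<close>.\<close>

definition pnum_const :: "(real ^ 'd) set \<Rightarrow> (real ^ 'd) set \<Rightarrow> (real ^ 'd) set \<Rightarrow>
    real \<Rightarrow> real \<Rightarrow> real \<Rightarrow> nat \<Rightarrow> bool" where
  "pnum_const X Z Y \<gamma> a b q \<longleftrightarrow> (\<forall>x\<in>X. \<forall>y\<in>Y. x \<bullet> y = \<gamma> \<longrightarrow> pnum Z a b x y = q)"

text \<open>The three alternatives for \<open>i, j, k\<close>; subtraction is on integers to avoid truncation.\<close>

definition triple_condition ::
    "(nat \<Rightarrow> nat) \<Rightarrow> (nat \<Rightarrow> (real ^ 'd) set) \<Rightarrow> nat \<Rightarrow> nat \<Rightarrow> nat \<Rightarrow> bool" where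
  "triple_condition t X i j k \<longleftrightarrow>
     int (num_angles X i j) + int (num_angles X j k) - 2 \<le> int (t j)
   \<or> int (num_angles X i j) + int (num_angles X j k) - 3 = int (t j) \<and>
     (\<forall>\<gamma>\<in>angles (X i) (X k). \<exists>a\<in>angles (X i) (X j). \<exists>b\<in>angles (X j) (X k).
        \<exists>q. pnum_const (X i) (X j) (X k) \<gamma> a b q)
   \<or> int (num_angles X i j) + int (num_angles X j k) - 4 = int (t j) \<and>
     (\<forall>\<gamma>\<in>angles (X i) (X k). \<exists>a\<in>angles (X i) (X j). \<exists>a'\<in>angles (X i) (X j).
        \<exists>b\<in>angles (X j) (X k). \<exists>b'\<in>angles (X j) (X k). a \<noteq> a' \<and> b \<noteq> b' \<and>
        (\<exists>q. pnum_const (X i) (X j) (X k) \<gamma> a b q) \<and>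
        (\<exists>q. pnum_const (X i) (X j) (X k) \<gamma> a b' q) \<and>
        (\<exists>q. pnum_const (X i) (X j) (X k) \<gamma> a' b q))"

text \<open>
  The families \<open>X\<close> and \<open>Y\<close> (of designs of the same strengths \<open>t\<close> in the same dimension) agree in all
  the data that are claimed to determine the parameters. In the last two clauses, the numbers assumed
  to be constant in the second, respectively third, alternative are taken at
  the same inner products and have the same values for \<open>X\<close> and for \<open>Y\<close>.
\<close>

definition same_data ::
    "nat \<Rightarrow> (nat \<Rightarrow> nat) \<Rightarrow> (nat \<Rightarrow> (real ^ 'd) set) \<Rightarrow> (nat \<Rightarrow> (real ^ 'd) set) \<Rightarrow> bool" where
  "same_data n t X Y \<longleftrightarrow>
     (\<forall>i\<in>{1..n}. card (X i) = card (Y i)) \<and>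
     (\<forall>i\<in>{1..n}. \<forall>j\<in>{1..n}. angles (X i) (X j) = angles (Y i) (Y j) \<and>
        (X i = X j \<longleftrightarrow> Y i = Y j) \<and> (X i = uminus ` X j \<longleftrightarrow> Y i = uminus ` Y j)) \<and>
     (\<forall>i\<in>{1..n}. \<forall>j\<in>{1..n}. \<forall>k\<in>{1..n}.
        (int (num_angles X i j) + int (num_angles X j k) - 3 = int (t j) \<longrightarrow>
          (\<forall>\<gamma>\<in>angles (X i) (X k). \<exists>a\<in>angles (X i) (X j). \<exists>b\<in>angles (X j) (X k).
             \<exists>q. pnum_const (X i) (X j) (X k) \<gamma> a b q \<and> pnum_const (Y i) (Y j) (Y k) \<gamma> a b q)) \<and>
        (int (num_angles X i j) + int (num_angles X j k) - 4 = int (t j) \<longrightarrow>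
          (\<forall>\<gamma>\<in>angles (X i) (X k). \<exists>a\<in>angles (X i) (X j). \<exists>a'\<in>angles (X i) (X j).
             \<exists>b\<in>angles (X j) (X k). \<exists>b'\<in>angles (X j) (X k). a \<noteq> a' \<and> b \<noteq> b' \<and>
             (\<exists>q. pnum_const (X i) (X j) (X k) \<gamma> a b q \<and> pnum_const (Y i) (Y j) (Y k) \<gamma> a b q) \<and>
             (\<exists>q. pnum_const (X i) (X j) (X k) \<gamma> a b' q \<and> pnum_const (Y i) (Y j) (Y k) \<gamma> a b' q) \<and>
             (\<exists>q. pnum_const (X i) (X j) (X k) \<gamma> a' b q \<and> pnum_const (Y i) (Y j) (Y k) \<gamma> a' b q))))"

end

theory Submission
  imports Defs
begin

text \<open>
  Fix \<open>i, j, k\<close> and points \<open>x \<in> X i\<close> and \<open>y \<in> X k\<close> with inner product \<open>\<gamma>\<close>, and consider the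
  numbers \<open>pnum (X j) a b x y\<close> as a function of \<open>a\<close> and \<open>b\<close>. If \<open>g\<close> is a product of at most
  \<open>t j\<close> factors \<open>a - u\<close> and \<open>b - v\<close> with constants \<open>u\<close> and \<open>v\<close>, then the sum of
  \<open>pnum (X j) a b x y * g a b\<close> over \<open>a, b\<close> is the sum of \<open>g (x \<bullet> z) (y \<bullet> z)\<close> over \<open>z \<in> X j\<close>,
  a polynomial function of \<open>z\<close> of degree at most \<open>t j\<close>. By the design property it is
  \<open>card (X j)\<close> times an average over the sphere, and by orthogonal invariance of the surface
  measure the average depends on \<open>\<gamma>\<close> only (\<open>design_moments_eq\<close>). The surface measure is
  invariant because Lebesgue measure is (\<open>distr_lborel_orthogonal\<close>), and pairs of unit
  vectors with equal inner products are related by an orthogonal map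
  (\<open>orthogonal_transformation_exists_2\<close>).

  So take a second pair \<open>x', y'\<close> with inner product \<open>\<gamma>\<close>, from the same family or from another
  one with the same data, and let \<open>c a b\<close> be the difference of the two counts. The
  contributions of the inner products \<open>1\<close> and \<open>- 1\<close> cancel, since they depend on \<open>\<gamma>\<close> and on
  coincidences between members of the family only (\<open>pnum_trivial_angle\<close>). Thus \<open>c\<close> lives on
  the grid \<open>angles (X i) (X j) \<times> angles (X j) (X k)\<close>, of size \<open>s \<times> s'\<close> say, and is orthogonal
  to all products as above. If the zeros of \<open>g\<close> cover the grid except for a set \<open>P \<times> Q\<close>, and
  \<open>c\<close> is known to vanish on \<open>P \<times> Q\<close> except at one point, then it vanishes there, too; such a
  \<open>g\<close> is available when \<open>s + s' \<le> t j + card P + card Q\<close> (\<open>vanishing_at_last_point\<close>). For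
  \<open>s + s' - 2 \<le> t j\<close> points suffice. For \<open>s + s' - 3 = t j\<close> one may use pairs of points in a
  line, so the one known value spreads over a row and then over all columns. For
  \<open>s + s' - 4 = t j\<close> one may use three points in a line and \<open>2 \<times> 2\<close> rectangles, so the three
  known values in the shape of a corner spread over a row and a column and then everywhere.
  The remaining inner products \<open>\<gamma> = 1\<close> and \<open>\<gamma> = - 1\<close> reduce to interpolation in one variable.
  All this is \<open>pnum_eq\<close>.

  Counting paths in the disjoint union amounts to these numbers (\<open>card_paths\<close>), which gives
  the regularity axiom as well as the dependence of the parameters on the data. The other
  axioms hold because the indices correspond bijectively to the inner products that occur
  (\<open>bij_betw_indices_inner_products\<close>) and unit vectors with inner product \<open>1\<close> are equal.
\<close>

section \<open>Orthogonal invariance of the surface measure\<close>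

lemma nn_integral_lborel_translate:
  fixes g :: "'a::euclidean_space \<Rightarrow> ennreal"
  assumes [measurable]: "g \<in> borel_measurable borel"
  shows "(\<integral>\<^sup>+y. g (c + y) \<partial>lborel) = (\<integral>\<^sup>+y. g y \<partial>lborel)"
proof -
  have "(\<integral>\<^sup>+y. g y \<partial>lborel) = (\<integral>\<^sup>+y. g y \<partial>distr lborel borel ((+) c))"
    by (simp only: lborel_distr_plus)
  also have "\<dots> = (\<integral>\<^sup>+y. g (c + y) \<partial>lborel)"
    by (subst nn_integral_distr) simp_all
  finally show ?thesis by simp
qed

lemma nn_integral_lborel_point_reflect:
  fixes g :: "'a::euclidean_space \<Rightarrow> ennreal"
  assumes [measurable]: "g \<in> borel_measurable borel"
  shows "(\<integral>\<^sup>+y. g (c - y) \<partial>lborel) = (\<integral>\<^sup>+y. g y \<partial>lborel)"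
proof -
  have "lborel = distr lborel borel (\<lambda>y. c - y :: 'a)"
    using lborel_affine[of "- 1" c] by (simp add: density_1)
  then have "(\<integral>\<^sup>+y. g y \<partial>lborel) = (\<integral>\<^sup>+y. g y \<partial>distr lborel borel (\<lambda>y. c - y))"
    by simp
  also have "\<dots> = (\<integral>\<^sup>+y. g (c - y) \<partial>lborel)"
    by (subst nn_integral_distr) simp_all
  finally show ?thesis by simp
qed

text \<open>
  The image of Lebesgue measure under \<open>f\<close> is translation invariant, so it is a multiple of Lebesgue
  measure; the multiple is \<open>1\<close> because \<open>f\<close> preserves the unit ball. The proportionality \<open>exch\<close> is the
  usual Fubini argument for uniqueness of an invariant measure: both of its sides are the double
  integral of the indicator of the pairs with \<open>f x \<in> A\<close> and \<open>f x + y \<in> B\<close>.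
\<close>

lemma distr_lborel_orthogonal:
  fixes f :: "'a::euclidean_space \<Rightarrow> 'a"
  assumes f: "orthogonal_transformation f"
  shows "distr lborel borel f = lborel"
proof (rule measure_eqI)
  have lin: "linear f" using f by (rule orthogonal_transformation_linear)
  have [measurable]: "f \<in> borel_measurable borel"
    using lin by (intro borel_measurable_continuous_onI linear_continuous_on linear_conv_bounded_linear[THEN iffD1])
  have pull: "(\<integral>\<^sup>+x. indicator A (f x) * c \<partial>lborel) = emeasure lborel (f -` A) * c"
    if [measurable]: "A \<in> sets borel" for A c
  proof -
    have "f -` A \<in> sets lborel"
      using measurable_sets_borel[of f borel A] that by simp
    moreover have "(\<lambda>x. indicator A (f x)) = (indicator (f -` A) :: 'a \<Rightarrow> ennreal)"
      by (auto simp: indicator_def)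
    ultimately have "(\<integral>\<^sup>+x. indicator A (f x) \<partial>lborel) = emeasure lborel (f -` A)"
      by (simp only: nn_integral_indicator)
    then show ?thesis
      by (simp add: nn_integral_multc)
  qed
  have exch: "emeasure lborel (f -` A) * emeasure lborel B
      = emeasure lborel (f -` B) * emeasure lborel A"
    if [measurable]: "A \<in> sets borel" "B \<in> sets borel" for A B
  proof -
    have "emeasure lborel (f -` A) * emeasure lborel B
        = (\<integral>\<^sup>+x. indicator A (f x) * emeasure lborel B \<partial>lborel)"
      by (simp add: pull)
    also have "\<dots> = (\<integral>\<^sup>+x. (\<integral>\<^sup>+y. indicator A (f x) * indicator B (f x + y) \<partial>lborel) \<partial>lborel)"
      by (subst nn_integral_cmult) (simp_all add: nn_integral_lborel_translate[of "indicator B"])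
    also have "\<dots> = (\<integral>\<^sup>+y. (\<integral>\<^sup>+x. indicator A (f x) * indicator B (f x + y) \<partial>lborel) \<partial>lborel)"
      by (rule lborel_pair.Fubini') simp
    also have "\<dots> = (\<integral>\<^sup>+y. (\<integral>\<^sup>+x. indicator A (f x - y) * indicator B (f x) \<partial>lborel) \<partial>lborel)"
    proof (rule nn_integral_cong)
      fix y
      obtain z where z: "f z = y"
        using orthogonal_transformation_surj[OF f] by (metis surjD)
      have "(\<integral>\<^sup>+x. indicator A (f x - y) * indicator B (f x) \<partial>lborel)
          = (\<integral>\<^sup>+x. indicator A (f (z + x) - y) * indicator B (f (z + x)) \<partial>lborel)"
        by (rule nn_integral_lborel_translate[symmetric]) simp
      then show "(\<integral>\<^sup>+x. indicator A (f x) * indicator B (f x + y) \<partial>lborel)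
          = (\<integral>\<^sup>+x. indicator A (f x - y) * indicator B (f x) \<partial>lborel)"
        by (simp add: linear_add[OF lin] z add.commute)
    qed
    also have "\<dots> = (\<integral>\<^sup>+x. (\<integral>\<^sup>+y. indicator A (f x - y) * indicator B (f x) \<partial>lborel) \<partial>lborel)"
      by (rule lborel_pair.Fubini') simp
    also have "\<dots> = (\<integral>\<^sup>+x. indicator B (f x) * emeasure lborel A \<partial>lborel)"
      by (subst nn_integral_multc)
        (simp_all add: nn_integral_lborel_point_reflect[of "indicator A"] mult.commute)
    also have "\<dots> = emeasure lborel (f -` B) * emeasure lborel A"
      by (simp add: pull)
    finally show ?thesis .
  qed
  fix A assume "A \<in> sets (distr lborel borel f)"
  then have [measurable]: "A \<in> sets borel" by simp
  have "f -` ball 0 1 = ball 0 1"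
    by (auto simp: orthogonal_transformation_norm[OF f])
  then have "emeasure lborel (ball (0::'a) 1) * emeasure lborel (f -` A)
      = emeasure lborel (ball (0::'a) 1) * emeasure lborel A"
    using exch[of A "ball 0 1"] by (simp add: mult.commute)
  moreover have "emeasure lborel (ball (0::'a) 1) \<noteq> 0" "emeasure lborel (ball (0::'a) 1) \<noteq> \<infinity>"
  proof -
    have "unit_ball_vol (real DIM('a)) \<noteq> 0"
      by (metis less_irrefl of_nat_0_le_iff unit_ball_vol_pos)
    then show "emeasure lborel (ball (0::'a) 1) \<noteq> 0" "emeasure lborel (ball (0::'a) 1) \<noteq> \<infinity>"
      by (simp_all add: emeasure_ball)
  qed
  ultimately have "emeasure lborel (f -` A) = emeasure lborel A"
    by (simp add: ennreal_mult_cancel_left)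
  then show "emeasure (distr lborel borel f) A = emeasure lborel A"
    by (simp add: emeasure_distr)
qed simp

text \<open>
  An orthogonal map commutes with \<open>sgn\<close> and preserves the punctured ball, so it carries the cone over
  a set to the cone over its image.
\<close>

lemma distr_sphere_measure_orthogonal:
  fixes f :: "real ^ 'd \<Rightarrow> real ^ 'd"
  assumes f: "orthogonal_transformation f"
  shows "f \<in> sphere_measure \<rightarrow>\<^sub>M sphere_measure"
    and "distr sphere_measure sphere_measure f = sphere_measure"
proof -
  let ?B = "ball 0 1 - {0 :: real ^ 'd}"
  have lin: "linear f" using f by (rule orthogonal_transformation_linear)
  have fm [measurable]: "f \<in> borel_measurable borel"
    using lin by (intro borel_measurable_continuous_onI linear_continuous_on linear_conv_bounded_linear[THEN iffD1])
  have nf: "norm (f x) = norm x" for x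
    by (rule orthogonal_transformation_norm[OF f])
  have sets: "sets sphere_measure = sets (restrict_space borel (sphere (0 :: real ^ 'd) 1))"
    by (simp add: sphere_measure_def)
  have "f \<in> restrict_space borel (sphere 0 1) \<rightarrow>\<^sub>M restrict_space borel (sphere 0 1)"
    by (rule measurable_restrict_space2)
      (auto simp: space_restrict_space nf intro: measurable_restrict_space1)
  then show meas: "f \<in> sphere_measure \<rightarrow>\<^sub>M sphere_measure"
    using measurable_cong_sets[OF sets sets] by blast
  have em: "emeasure sphere_measure E = of_nat CARD('d) * emeasure lborel (sgn -` E \<inter> ?B)"
    if "E \<in> sets sphere_measure" for E :: "(real ^ 'd) set"
    using that sets
    by (auto simp: sphere_measure_def emeasure_distr[OF measurable_sgn_sphere]
        space_restrict_space emeasure_restrict_space)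
  show "distr sphere_measure sphere_measure f = sphere_measure"
  proof (rule measure_eqI)
    fix E :: "(real ^ 'd) set" assume "E \<in> sets (distr sphere_measure sphere_measure f)"
    then have E: "E \<in> sets sphere_measure" by simp
    let ?C = "sgn -` E \<inter> ?B"
    have "sgn -` E \<inter> space (restrict_space lborel ?B) \<in> sets (restrict_space lborel ?B)"
      using measurable_sets[OF measurable_sgn_sphere] E sets by blast
    then have C [measurable]: "?C \<in> sets borel"
      by (auto simp: sets_restrict_space_iff space_restrict_space)
    have sgnf: "sgn (f x) = f (sgn x)" for x
      by (simp add: sgn_div_norm nf linear_scale[OF lin])
    have f0: "f x = 0 \<longleftrightarrow> x = 0" for x
      using nf[of x] by (metis norm_eq_zero)
    have "emeasure (distr sphere_measure sphere_measure f) E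
        = emeasure sphere_measure (f -` E \<inter> sphere 0 1)"
      using E meas by (simp add: emeasure_distr)
    also have "\<dots> = of_nat CARD('d) * emeasure lborel (sgn -` (f -` E \<inter> sphere 0 1) \<inter> ?B)"
      using measurable_sets[OF meas E] by (intro em) simp
    also have "sgn -` (f -` E \<inter> sphere 0 1) \<inter> ?B = f -` ?C"
      by (auto simp: sgnf nf f0 norm_sgn)
    also have "emeasure lborel (f -` ?C) = emeasure (distr lborel borel f) ?C"
      by (simp add: emeasure_distr)
    also have "\<dots> = emeasure lborel ?C"
      by (simp add: distr_lborel_orthogonal[OF f])
    finally show "emeasure (distr sphere_measure sphere_measure f) E = emeasure sphere_measure E"
      using em[OF E] by simp
  qed simp
qed

lemma integral_sphere_measure_orthogonal:
  fixes f :: "real ^ 'd \<Rightarrow> real ^ 'd" and g :: "real ^ 'd \<Rightarrow> real"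
  assumes f: "orthogonal_transformation f" and g: "continuous_on UNIV g"
  shows "integral\<^sup>L sphere_measure (\<lambda>x. g (f x)) = integral\<^sup>L sphere_measure g"
proof -
  have "g \<in> borel_measurable (restrict_space borel (sphere 0 1))"
    using g by (intro measurable_restrict_space1 borel_measurable_continuous_onI)
  moreover have "sets (sphere_measure :: (real ^ 'd) measure) = sets (restrict_space borel (sphere 0 1))"
    by (simp add: sphere_measure_def)
  ultimately have "g \<in> borel_measurable sphere_measure"
    using measurable_cong_sets by blast
  from integral_distr[OF distr_sphere_measure_orthogonal(1)[OF f] this]
  show ?thesis by (simp add: distr_sphere_measure_orthogonal(2)[OF f])
qed

section \<open>Orthogonal maps between pairs of vectors\<close>

text \<open>
  For \<open>v = 0\<close> division by zero makes this the identity, which is what the direction \<open>x - x'\<close> calls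
  for when \<open>x = x'\<close>.
\<close>

definition hyperplane_reflection :: "'a::real_inner \<Rightarrow> 'a \<Rightarrow> 'a" where
  "hyperplane_reflection v z = z - (2 * (v \<bullet> z) / (v \<bullet> v)) *\<^sub>R v"

lemma orthogonal_transformation_hyperplane_reflection:
  "orthogonal_transformation (hyperplane_reflection v)"
proof (cases "v = 0")
  case True
  then show ?thesis by (simp add: hyperplane_reflection_def[abs_def])
next
  case False
  have "linear (hyperplane_reflection v)"
    by (rule linearI) (simp_all add: hyperplane_reflection_def algebra_simps inner_simps add_divide_distrib)
  then show ?thesis
    using False
    by (auto simp: orthogonal_transformation_def hyperplane_reflection_def inner_diff_left inner_diff_right
        inner_commute field_simps)
qed

lemma hyperplane_reflection_swap:
  assumes "norm x = norm x'"
  shows "hyperplane_reflection (x - x') x = x'"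
proof (cases "x = x'")
  case False
  have "2 * ((x - x') \<bullet> x) = (x - x') \<bullet> (x - x')"
    using assms by (simp add: inner_diff_left inner_diff_right inner_commute norm_eq)
  then show ?thesis using False by (simp add: hyperplane_reflection_def)
qed (simp add: hyperplane_reflection_def)

text \<open>
  The orthogonal group acts transitively on pairs of vectors with prescribed norms and inner product.
  Reflect \<open>x\<close> to \<open>x'\<close>; the reflection that then moves the image of \<open>y\<close> to \<open>y'\<close> fixes \<open>x'\<close>, because
  equality of the inner products makes \<open>x'\<close> orthogonal to the direction of reflection.
\<close>

lemma orthogonal_transformation_exists_2:
  fixes x y x' y' :: "'a::real_inner"
  assumes "norm x = norm x'" "norm y = norm y'" "x \<bullet> y = x' \<bullet> y'"
  obtains f where "orthogonal_transformation f" "f x = x'" "f y = y'"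
proof
  let ?g = "hyperplane_reflection (x - x')"
  let ?h = "hyperplane_reflection (?g y - y')"
  have g: "orthogonal_transformation ?g" by (rule orthogonal_transformation_hyperplane_reflection)
  have gx: "?g x = x'" using assms(1) by (rule hyperplane_reflection_swap)
  show "orthogonal_transformation (?h \<circ> ?g)"
    by (intro orthogonal_transformation_compose orthogonal_transformation_hyperplane_reflection)
  have "x' \<bullet> ?g y = x \<bullet> y"
    using g gx unfolding orthogonal_transformation_def by metis
  then have "(?g y - y') \<bullet> x' = 0"
    using assms(3) by (simp add: inner_commute[of _ x'] inner_diff_right)
  then have "?h x' = x'"
    by (simp add: hyperplane_reflection_def[of "?g y - y'"])
  then show "(?h \<circ> ?g) x = x'"
    by (simp add: gx)
  have "norm (?g y) = norm y'"
    using orthogonal_transformation_norm[OF g, of y] assms(2) by simp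
  then show "(?h \<circ> ?g) y = y'"
    by (simp add: hyperplane_reflection_swap)
qed

section \<open>Polynomial functions and moments of designs\<close>

lemma poly_fun_lift:
  assumes "g \<in> range (poly_fun t)" "t \<le> t'"
  shows "g \<in> range (poly_fun t')"
proof -
  obtain c where c: "g = poly_fun t c" using assms(1) by blast
  have "g x = poly_fun t' (\<lambda>a. if (\<Sum>i\<in>UNIV. a i) \<le> t then c a else 0) x" for x
    unfolding c poly_fun_def using assms(2)
    by (intro sum.mono_neutral_cong_left finite_exponents) auto
  then show ?thesis by (intro range_eqI ext)
qed

lemma poly_fun_const: "(\<lambda>_ :: real ^ 'd. k) \<in> range (poly_fun t)"
proof -
  have "poly_fun t (\<lambda>a. if a = (\<lambda>_. 0) then k else 0) x = k" for x :: "real ^ 'd"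
  proof -
    have "poly_fun t (\<lambda>a. if a = (\<lambda>_. 0) then k else 0) x
        = (\<Sum>a\<in>{\<lambda>_. 0}. (if a = (\<lambda>_. 0) then k else 0) * (\<Prod>i\<in>UNIV. (x $ i) ^ a i))"
      unfolding poly_fun_def by (intro sum.mono_neutral_right finite_exponents) auto
    then show ?thesis by simp
  qed
  then have "(\<lambda>_ :: real ^ 'd. k) = poly_fun t (\<lambda>a. if a = (\<lambda>_. 0) then k else 0)"
    by (intro ext) simp
  then show ?thesis by (rule range_eqI[where f = "poly_fun t"])
qed

lemma poly_fun_add:
  assumes "g \<in> range (poly_fun t)" "h \<in> range (poly_fun t)"
  shows "(\<lambda>x. g x + h x) \<in> range (poly_fun t)"
proof -
  obtain c c' where c: "g = poly_fun t c" "h = poly_fun t c'" using assms by blast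
  have "g x + h x = poly_fun t (\<lambda>a. c a + c' a) x" for x
    unfolding c poly_fun_def by (simp add: sum.distrib algebra_simps)
  then show ?thesis by (intro range_eqI ext)
qed

lemma poly_fun_scale:
  assumes "g \<in> range (poly_fun t)"
  shows "(\<lambda>x. k * g x) \<in> range (poly_fun t)"
proof -
  obtain c where c: "g = poly_fun t c" using assms by blast
  have "k * g x = poly_fun t (\<lambda>a. k * c a) x" for x
    unfolding c poly_fun_def by (simp add: sum_distrib_left mult.assoc)
  then show ?thesis by (intro range_eqI ext)
qed

lemma poly_fun_sum:
  assumes "finite I" "\<And>i. i \<in> I \<Longrightarrow> g i \<in> range (poly_fun t)"
  shows "(\<lambda>x. \<Sum>i\<in>I. g i x) \<in> range (poly_fun t)"
  using assms by (induction I) (simp_all add: poly_fun_const poly_fun_add)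

text \<open>
  Multiplication by \<open>x $ i\<close> raises the \<open>i\<close>-th exponent by one, so the coefficient at \<open>a\<close> is inherited
  from the exponent vector with \<open>a i\<close> lowered by one.
\<close>

lemma poly_fun_coordinate:
  fixes g :: "real ^ 'd \<Rightarrow> real"
  assumes "g \<in> range (poly_fun t)"
  shows "(\<lambda>x. x $ i * g x) \<in> range (poly_fun (Suc t))"
proof -
  obtain c where c: "g = poly_fun t c" using assms by blast
  let ?up = "\<lambda>a :: 'd \<Rightarrow> nat. a(i := Suc (a i))"
  let ?dn = "\<lambda>a :: 'd \<Rightarrow> nat. a(i := a i - 1)"
  have up_sum: "(\<Sum>j\<in>UNIV. ?up a j) = Suc (\<Sum>j\<in>UNIV. a j)" for a
    by (simp add: sum.remove[of UNIV i])
  have up_prod: "(\<Prod>j\<in>UNIV. (x $ j) ^ ?up a j) = x $ i * (\<Prod>j\<in>UNIV. (x $ j) ^ a j)"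
    for a and x :: "real ^ 'd"
    by (simp add: prod.remove[of UNIV i])
  have up_dn: "?up (?dn a) = a" if "a i \<noteq> 0" for a
    using that by auto
  have "x $ i * g x = poly_fun (Suc t) (\<lambda>a. if a i = 0 then 0 else c (?dn a)) x" for x
  proof -
    have "x $ i * g x
        = (\<Sum>a | (\<Sum>j\<in>UNIV. a j) \<le> t. c a * (\<Prod>j\<in>UNIV. (x $ j) ^ ?up a j))"
      unfolding c poly_fun_def up_prod by (simp add: sum_distrib_left mult.left_commute)
    also have "\<dots> = (\<Sum>a | (\<Sum>j\<in>UNIV. a j) \<le> Suc t \<and> a i \<noteq> 0.
        c (?dn a) * (\<Prod>j\<in>UNIV. (x $ j) ^ a j))"
    proof (rule sum.reindex_bij_witness[where i = ?dn and j = ?up])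
      fix a :: "'d \<Rightarrow> nat" assume a: "a \<in> {a. (\<Sum>j\<in>UNIV. a j) \<le> Suc t \<and> a i \<noteq> 0}"
      then have "Suc (\<Sum>j\<in>UNIV. ?dn a j) = (\<Sum>j\<in>UNIV. a j)"
        using up_sum[of "?dn a"] up_dn[of a] by simp
      then show "?dn a \<in> {a. (\<Sum>j\<in>UNIV. a j) \<le> t}" using a by simp
      show "?up (?dn a) = a" using a by (intro up_dn) simp
    next
      fix a :: "'d \<Rightarrow> nat" assume "a \<in> {a. (\<Sum>j\<in>UNIV. a j) \<le> t}"
      then show "?up a \<in> {a. (\<Sum>j\<in>UNIV. a j) \<le> Suc t \<and> a i \<noteq> 0}"
        using up_sum[of a] by simp
      show "?dn (?up a) = a" by simp
      then show "c (?dn (?up a)) * (\<Prod>j\<in>UNIV. (x $ j) ^ ?up a j)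
          = c a * (\<Prod>j\<in>UNIV. (x $ j) ^ ?up a j)" by simp
    qed
    also have "\<dots> = poly_fun (Suc t) (\<lambda>a. if a i = 0 then 0 else c (?dn a)) x"
      unfolding poly_fun_def by (intro sum.mono_neutral_cong_left finite_exponents) auto
    finally show ?thesis .
  qed
  then show ?thesis by (intro range_eqI ext)
qed

lemma poly_fun_affine:
  assumes "g \<in> range (poly_fun t)"
  shows "(\<lambda>z. (x \<bullet> z - a) * g z) \<in> range (poly_fun (Suc t))"
proof -
  have "(\<lambda>z. (\<Sum>i\<in>UNIV. x $ i * (z $ i * g z)) + - a * g z) \<in> range (poly_fun (Suc t))"
    by (intro poly_fun_add poly_fun_sum poly_fun_scale poly_fun_coordinate assms
        poly_fun_lift[OF assms]) auto
  moreover have "(\<Sum>i\<in>UNIV. x $ i * (z $ i * g z)) + - a * g z = (x \<bullet> z - a) * g z" for z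
    by (simp add: inner_vec_def sum_distrib_right mult.assoc left_diff_distrib)
  ultimately show ?thesis by simp
qed

text \<open>
  These products, rather than the monomials in \<open>x \<bullet> z\<close> and \<open>y \<bullet> z\<close>, are the test functions used
  below: their zero sets are chosen to isolate a few pairs of inner products.
\<close>

lemma poly_fun_prod_affine:
  assumes "finite F" "finite G" "card F + card G \<le> t"
  shows "(\<lambda>z. (\<Prod>a\<in>F. x \<bullet> z - a) * (\<Prod>b\<in>G. y \<bullet> z - b)) \<in> range (poly_fun t)"
proof -
  have "(\<lambda>z. \<Prod>b\<in>G. y \<bullet> z - b) \<in> range (poly_fun (card G))"
    using \<open>finite G\<close> by (induction G) (simp_all add: poly_fun_const poly_fun_affine)
  with \<open>finite F\<close>
  have "(\<lambda>z. (\<Prod>a\<in>F. x \<bullet> z - a) * (\<Prod>b\<in>G. y \<bullet> z - b)) \<in> range (poly_fun (card F + card G))"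
    by (induction F) (simp_all add: poly_fun_affine mult.assoc)
  then show ?thesis using assms(3) by (rule poly_fun_lift)
qed

text \<open>
  Both sums are \<open>card Z\<close> times an average over the sphere, and an orthogonal map taking \<open>x, y\<close> to
  \<open>x', y'\<close> identifies the two averages.
\<close>

lemma design_moments_eq:
  fixes Z Z' :: "(real ^ 'd) set"
  assumes Z: "spherical_design t Z" and Z': "spherical_design t Z'" and card: "card Z = card Z'"
    and xy: "norm x = norm x'" "norm y = norm y'" "x \<bullet> y = x' \<bullet> y'"
    and FG: "finite F" "finite G" "card F + card G \<le> t"
  shows "(\<Sum>z\<in>Z. (\<Prod>a\<in>F. x \<bullet> z - a) * (\<Prod>b\<in>G. y \<bullet> z - b))
       = (\<Sum>z\<in>Z'. (\<Prod>a\<in>F. x' \<bullet> z - a) * (\<Prod>b\<in>G. y' \<bullet> z - b))"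
proof -
  let ?g = "\<lambda>x y z :: real ^ 'd. (\<Prod>a\<in>F. x \<bullet> z - a) * (\<Prod>b\<in>G. y \<bullet> z - b)"
  let ?vol = "measure (sphere_measure :: (real ^ 'd) measure) (sphere 0 1)"
  have mean: "(\<Sum>z\<in>W. ?g u v z) = card W * (integral\<^sup>L sphere_measure (?g u v) / ?vol)"
    if "spherical_design t W" for W u v
  proof -
    obtain c where c: "?g u v = poly_fun t c"
      using poly_fun_prod_affine[OF FG] by blast
    have "card W \<noteq> 0" using that by (auto simp: spherical_design_def)
    moreover have "(\<Sum>z\<in>W. poly_fun t c z) / card W = integral\<^sup>L sphere_measure (poly_fun t c) / ?vol"
      using that by (auto simp: spherical_design_def)
    ultimately show ?thesis unfolding c by (simp add: field_simps)
  qed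
  obtain f where f: "orthogonal_transformation f" "f x = x'" "f y = y'"
    using orthogonal_transformation_exists_2[OF xy] .
  have inner: "x' \<bullet> f z = x \<bullet> z" "y' \<bullet> f z = y \<bullet> z" for z
    using f unfolding orthogonal_transformation_def by metis+
  have "integral\<^sup>L sphere_measure (?g x' y') = integral\<^sup>L sphere_measure (\<lambda>z. ?g x' y' (f z))"
    by (rule integral_sphere_measure_orthogonal[OF f(1), symmetric]) (intro continuous_intros)
  also have "\<dots> = integral\<^sup>L sphere_measure (?g x y)"
    by (simp add: inner)
  finally show ?thesis
    using mean[OF Z, of x y] mean[OF Z', of x' y'] card by simp
qed

section \<open>Interpolation on a grid\<close>

text \<open>
  This replaces the inversion of a (possibly defective) tensor product of Vandermonde matrices. The
  polynomial in two variables that vanishes on the rows outside \<open>P\<close> and on the columns outside \<open>Q\<close> has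
  degree \<open>card (A - P) + card (B - Q) \<le> t\<close>; tested against it, only the value at \<open>(p, q)\<close> survives.

  When \<open>card A + card B - t\<close> is at most \<open>2\<close>, one may take \<open>P\<close> and \<open>Q\<close> to be singletons and obtains
  \<open>c = 0\<close> at once. When it is \<open>3\<close> or \<open>4\<close>, larger \<open>P\<close> and \<open>Q\<close> propagate known zeros of \<open>c\<close>.
\<close>

lemma vanishing_at_last_point:
  fixes c :: "real \<Rightarrow> real \<Rightarrow> real"
  assumes fin: "finite A" "finite B"
    and ann: "\<And>F G. finite F \<Longrightarrow> finite G \<Longrightarrow> card F + card G \<le> t \<Longrightarrow>
        (\<Sum>a\<in>A. \<Sum>b\<in>B. c a b * ((\<Prod>u\<in>F. a - u) * (\<Prod>v\<in>G. b - v))) = 0"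
    and PQ: "P \<subseteq> A" "Q \<subseteq> B" "card A + card B \<le> t + card P + card Q"
    and p: "p \<in> P" and q: "q \<in> Q"
    and zero: "\<And>a b. a \<in> P \<Longrightarrow> b \<in> Q \<Longrightarrow> (a, b) \<noteq> (p, q) \<Longrightarrow> c a b = 0"
  shows "c p q = 0"
proof -
  let ?w = "\<lambda>a b. (\<Prod>u\<in>A - P. a - u) * (\<Prod>v\<in>B - Q. b - v)"
  have finPQ: "finite P" "finite Q" using PQ(1,2) fin by (auto intro: finite_subset)
  have zero_term: "c a b * ?w a b = 0" if "a \<in> A" "b \<in> B" "(a, b) \<noteq> (p, q)" for a b
    using that fin zero[of a b] by (cases "a \<in> P"; cases "b \<in> Q") auto
  have "card (A - P) + card (B - Q) \<le> t"
    using PQ card_mono[OF fin(1) PQ(1)] card_mono[OF fin(2) PQ(2)] finPQ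
    by (simp add: card_Diff_subset)
  then have "0 = (\<Sum>a\<in>A. \<Sum>b\<in>B. c a b * ?w a b)"
    using ann[of "A - P" "B - Q"] fin by simp
  also have "\<dots> = (\<Sum>(a, b)\<in>A \<times> B. c a b * ?w a b)"
    by (simp add: sum.cartesian_product)
  also have "\<dots> = (\<Sum>(a, b)\<in>{(p, q)}. c a b * ?w a b)"
  proof (rule sum.mono_neutral_right)
    show "\<forall>ab\<in>A \<times> B - {(p, q)}. (case ab of (a, b) \<Rightarrow> c a b * ?w a b) = 0"
      using zero_term by fast
  qed (use fin p q PQ(1,2) in auto)
  finally have "c p q * ?w p q = 0" by simp
  moreover have "?w p q \<noteq> 0" using p q fin by auto
  ultimately show ?thesis by simp
qed

section \<open>Inner products in families of designs\<close>

lemma inner_eq_1_unit: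
  fixes x z :: "'a::real_inner"
  assumes "norm x = 1" "norm z = 1"
  shows "x \<bullet> z = 1 \<longleftrightarrow> x = z"
proof
  assume "x \<bullet> z = 1"
  then have "norm (x - z) ^ 2 = 0"
    using assms by (simp add: power2_norm_eq_inner inner_diff_left inner_diff_right inner_commute norm_eq_1)
  then show "x = z" by simp
qed (use assms in \<open>simp add: norm_eq_1\<close>)

lemma inner_eq_minus_1_unit:
  fixes x z :: "'a::real_inner"
  assumes "norm x = 1" "norm z = 1"
  shows "x \<bullet> z = - 1 \<longleftrightarrow> z = - x"
  using inner_eq_1_unit[of x "- z"] assms by auto

lemma angles_iff:
  assumes "X \<subseteq> sphere 0 1" "Y \<subseteq> sphere 0 1"
  shows "g \<in> angles X Y \<longleftrightarrow> g \<noteq> 1 \<and> g \<noteq> - 1 \<and> (\<exists>x\<in>X. \<exists>y\<in>Y. x \<bullet> y = g)"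
proof -
  have "x \<bullet> y = 1 \<longleftrightarrow> x = y" "x \<bullet> y = - 1 \<longleftrightarrow> x = - y" if "x \<in> X" "y \<in> Y" for x y
    using that assms inner_eq_1_unit[of x y] inner_eq_minus_1_unit[of x y] by (auto simp: subset_iff)
  then show ?thesis unfolding angles_def by auto blast+
qed

lemma angles_commute: "angles X Y = angles Y X"
  unfolding angles_def by (auto simp: inner_commute) (metis add.inverse_inverse inner_commute)+

lemma angles_uminus_left: "angles (uminus ` X) Y = uminus ` angles X Y"
proof -
  have sub: "uminus ` angles X Y \<subseteq> angles (uminus ` X) Y" for X Y :: "(real ^ 'd) set"
    unfolding angles_def by (force simp: image_iff)
  have "uminus ` uminus ` angles (uminus ` X) Y \<subseteq> uminus ` angles (uminus ` uminus ` X) Y"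
    using sub[of "uminus ` X" Y] by (rule image_mono)
  then show ?thesis using sub[of X Y] by (simp add: image_image)
qed

lemma finite_angles:
  assumes "finite X" "finite Y"
  shows "finite (angles X Y)"
proof (rule finite_subset)
  show "angles X Y \<subseteq> (\<lambda>(x, y). x \<bullet> y) ` (X \<times> Y)" unfolding angles_def by auto
qed (use assms in simp)

lemma design_familyD:
  assumes "design_family n t X" "i \<in> {1..n}"
  shows "finite (X i)" "X i \<noteq> {}" "X i \<subseteq> sphere 0 1" "spherical_design (t i) (X i)"
  using assms by (auto simp: design_family_def)

lemma design_family_norm:
  assumes "design_family n t X" "i \<in> {1..n}" "x \<in> X i"
  shows "norm x = 1"
  using design_familyD(3)[OF assms(1,2)] assms(3) by auto

text \<open>
  Whether \<open>x\<close> or \<open>- x\<close> lies in another member of the family does not depend on the point \<open>x\<close>; this is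
  what the hypothesis that two members are equal or disjoint, up to sign, provides.
\<close>

lemma design_family_mem_iff:
  assumes "design_family n t X" "i \<in> {1..n}" "j \<in> {1..n}" "x \<in> X i"
  shows "x \<in> X j \<longleftrightarrow> X i = X j" and "- x \<in> X j \<longleftrightarrow> X i = uminus ` X j"
proof -
  have eq: "X i \<inter> X j = {} \<or> X i = X j" "X i \<inter> uminus ` X j = {} \<or> X i = uminus ` X j"
    using assms by (auto simp: design_family_def)
  have "- x \<in> X j \<longleftrightarrow> x \<in> uminus ` X j" by (force simp: image_iff)
  then show "x \<in> X j \<longleftrightarrow> X i = X j" "- x \<in> X j \<longleftrightarrow> X i = uminus ` X j"
    using eq assms(4) by auto
qed

lemma pnum_commute: "pnum Z a b x y = pnum Z b a y x"
  unfolding pnum_def by (rule arg_cong[of _ _ card]) auto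

text \<open>
  Outside \<open>angles X Z\<close> the only possible inner products are \<open>1\<close> and \<open>- 1\<close>, and these force \<open>z = x\<close> and
  \<open>z = - x\<close>, respectively.
\<close>

lemma pnum_trivial_angle:
  assumes "norm x = 1" "Z \<subseteq> sphere 0 1" "x \<in> X" "X \<subseteq> sphere 0 1" "a \<notin> angles X Z"
  shows "pnum Z a b x y
    = of_bool (a = 1 \<and> x \<in> Z \<and> x \<bullet> y = b \<or> a = - 1 \<and> - x \<in> Z \<and> - (x \<bullet> y) = b)"
proof -
  have Z1: "norm z = 1" if "z \<in> Z" for z using assms(2) that by auto
  consider "a = 1" | "a = - 1" | "a \<noteq> 1" "a \<noteq> - 1" by blast
  then show ?thesis
  proof cases
    case 1
    then have "{z \<in> Z. x \<bullet> z = a \<and> y \<bullet> z = b} = (if x \<in> Z \<and> x \<bullet> y = b then {x} else {})"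
      using inner_eq_1_unit[OF assms(1)] Z1 by (auto simp: inner_commute)
    with 1 show ?thesis by (simp add: pnum_def)
  next
    case 2
    then have "{z \<in> Z. x \<bullet> z = a \<and> y \<bullet> z = b} = (if - x \<in> Z \<and> - (x \<bullet> y) = b then {- x} else {})"
      using inner_eq_minus_1_unit[OF assms(1)] Z1 by (auto simp: inner_commute)
    with 2 show ?thesis by (simp add: pnum_def)
  next
    case 3
    then have "{z \<in> Z. x \<bullet> z = a \<and> y \<bullet> z = b} = {}"
      using assms(3,5) angles_iff[OF assms(4,2)] by blast
    then have "pnum Z a b x y = 0"
      unfolding pnum_def by (simp only: card.empty)
    with 3 show ?thesis by simp
  qed
qed

lemma sum_by_angles:
  assumes "finite Z" "finite A" "finite B" "\<And>z. z \<in> Z \<Longrightarrow> x \<bullet> z \<in> A \<and> y \<bullet> z \<in> B"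
  shows "(\<Sum>z\<in>Z. h (x \<bullet> z) (y \<bullet> z)) = (\<Sum>(a, b)\<in>A \<times> B. real (pnum Z a b x y) * h a b)"
proof -
  let ?g = "\<lambda>z. (x \<bullet> z, y \<bullet> z)"
  have "(\<Sum>z\<in>Z. h (x \<bullet> z) (y \<bullet> z))
      = (\<Sum>ab\<in>A \<times> B. \<Sum>z\<in>{z\<in>Z. ?g z = ab}. h (x \<bullet> z) (y \<bullet> z))"
    by (rule sum.group[symmetric]) (use assms in auto)
  also have "\<dots> = (\<Sum>(a, b)\<in>A \<times> B. real (pnum Z a b x y) * h a b)"
    by (intro sum.cong) (auto simp: pnum_def)
  finally show ?thesis .
qed

section \<open>Determination of the counting numbers\<close>

text \<open>
  Both parts of the theorem are instances: with \<open>Y = X\<close> it says that the numbers are constant on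
  each relation, and for general \<open>Y\<close> that they are determined by the data. The difference \<open>c\<close> of the
  two counting functions is supported on \<open>A \<times> B\<close> and is annihilated by all products of linear factors
  of total degree at most \<open>t j\<close>, so that \<open>vanishing_at_last_point\<close> applies.
\<close>

lemma pnum_eq:
  assumes X: "design_family n t X" and Y: "design_family n t Y"
    and same: "same_data n t X Y" and triple: "triple_condition t X i j k"
    and ijk: "i \<in> {1..n}" "j \<in> {1..n}" "k \<in> {1..n}"
    and x: "x \<in> X i" and y: "y \<in> X k" and x': "x' \<in> Y i" and y': "y' \<in> Y k"
    and xy: "x \<bullet> y = x' \<bullet> y'"
  shows "pnum (X j) a b x y = pnum (Y j) a b x' y'"
proof -
  define A where "A = angles (X i) (X j)"
  define B where "B = angles (X j) (X k)"
  define c where "c a b = real (pnum (X j) a b x y) - real (pnum (Y j) a b x' y')" for a b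
  note Xi = design_familyD[OF X ijk(1)] and Xj = design_familyD[OF X ijk(2)]
    and Xk = design_familyD[OF X ijk(3)]
  note Yi = design_familyD[OF Y ijk(1)] and Yj = design_familyD[OF Y ijk(2)]
    and Yk = design_familyD[OF Y ijk(3)]
  note norms = design_family_norm[OF X ijk(1) x] design_family_norm[OF X ijk(3) y]
    design_family_norm[OF Y ijk(1) x'] design_family_norm[OF Y ijk(3) y']
  have angles: "angles (Y u) (Y v) = angles (X u) (X v)"
    and eq_iff: "X u = X v \<longleftrightarrow> Y u = Y v" "X u = uminus ` X v \<longleftrightarrow> Y u = uminus ` Y v"
    if "u \<in> {1..n}" "v \<in> {1..n}" for u v
    using same that unfolding same_data_def by auto
  have card_j: "card (X j) = card (Y j)"
    using same ijk(2) unfolding same_data_def by auto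
  have fin: "finite A" "finite B"
    using Xi(1) Xj(1) Xk(1) by (auto simp: A_def B_def finite_angles)
  have s: "num_angles X i j = card A" "num_angles X j k = card B"
    by (simp_all add: num_angles_def A_def B_def)
  have t1: "1 \<le> t j" using Xj(4) by (simp add: spherical_design_def)

  \<comment> \<open>Counts at the inner products 1 and -1 depend only on the inner product of x and y and on
    which members of the family coincide up to sign, so these inner products do not contribute.\<close>
  have zero_left: "c a b = 0" if "a \<notin> A" for a b
  proof -
    have "pnum (X j) a b x y = pnum (Y j) a b x' y'"
      using that norms x x' xy Xi Xj Yi Yj eq_iff[OF ijk(1,2)] angles[OF ijk(1,2)]
      by (simp add: A_def pnum_trivial_angle[of x _ "X i"] pnum_trivial_angle[of x' _ "Y i"]
          design_family_mem_iff[OF X ijk(1,2) x] design_family_mem_iff[OF Y ijk(1,2) x'])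
    then show ?thesis by (simp add: c_def)
  qed
  have zero_right: "c a b = 0" if "b \<notin> B" for a b
  proof -
    have "pnum (X j) b a y x = pnum (Y j) b a y' x'"
      using that norms y y' xy Xk Xj Yk Yj eq_iff[OF ijk(3,2)] angles[OF ijk(3,2)]
      by (simp add: B_def angles_commute[of "X j"] pnum_trivial_angle[of y _ "X k"]
          pnum_trivial_angle[of y' _ "Y k"] inner_commute[of y] inner_commute[of y']
          design_family_mem_iff[OF X ijk(3,2) y] design_family_mem_iff[OF Y ijk(3,2) y'])
    then show ?thesis by (simp add: c_def pnum_commute[of _ a b])
  qed

  have ann: "(\<Sum>a\<in>A. \<Sum>b\<in>B. c a b * ((\<Prod>u\<in>F. a - u) * (\<Prod>v\<in>G. b - v))) = 0"
    if FG: "finite F" "finite G" "card F + card G \<le> t j" for F G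
  proof -
    let ?A = "A \<union> {1, - 1}" and ?B = "B \<union> {1, - 1}"
    let ?w = "\<lambda>a b. (\<Prod>u\<in>F. a - u) * (\<Prod>v\<in>G. b - v)"
    have inX: "x \<bullet> z \<in> ?A \<and> y \<bullet> z \<in> ?B" if "z \<in> X j" for z
      using that x y angles_iff[OF Xi(3) Xj(3)] angles_iff[OF Xj(3) Xk(3)]
      by (auto simp: A_def B_def inner_commute[of y])
    have inY: "x' \<bullet> z \<in> ?A \<and> y' \<bullet> z \<in> ?B" if "z \<in> Y j" for z
      using that x' y' angles_iff[OF Yi(3) Yj(3)] angles_iff[OF Yj(3) Yk(3)] ijk
      by (auto simp: A_def B_def inner_commute[of y'] angles)
    have "(\<Sum>z\<in>X j. ?w (x \<bullet> z) (y \<bullet> z)) = (\<Sum>z\<in>Y j. ?w (x' \<bullet> z) (y' \<bullet> z))"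
      using norms by (intro design_moments_eq[OF Xj(4) Yj(4) card_j _ _ xy FG]) simp_all
    then have "(\<Sum>(a, b)\<in>?A \<times> ?B. real (pnum (X j) a b x y) * ?w a b)
        = (\<Sum>(a, b)\<in>?A \<times> ?B. real (pnum (Y j) a b x' y') * ?w a b)"
      using sum_by_angles[OF Xj(1) _ _ inX, of ?w] sum_by_angles[OF Yj(1) _ _ inY, of ?w] fin
      by simp
    then have "0 = (\<Sum>(a, b)\<in>?A \<times> ?B. c a b * ?w a b)"
      by (simp add: c_def left_diff_distrib sum_subtractf case_prod_unfold)
    also have "\<dots> = (\<Sum>(a, b)\<in>A \<times> B. c a b * ?w a b)"
    proof (rule sum.mono_neutral_right)
      have "c a b * ?w a b = 0" if "(a, b) \<notin> A \<times> B" for a b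
        using that zero_left[of a b] zero_right[of b a] by fastforce
      then show "\<forall>ab\<in>?A \<times> ?B - A \<times> B. (case ab of (a, b) \<Rightarrow> c a b * ?w a b) = 0"
        by fast
    qed (use fin in auto)
    finally show ?thesis by (simp add: sum.cartesian_product)
  qed
  have last: "c p q = 0"
    if "P \<subseteq> A" "Q \<subseteq> B" "card A + card B \<le> t j + card P + card Q" "p \<in> P" "q \<in> Q"
      "\<And>a b. a \<in> P \<Longrightarrow> b \<in> Q \<Longrightarrow> (a, b) \<noteq> (p, q) \<Longrightarrow> c a b = 0" for P Q p q
    by (rule vanishing_at_last_point[of A B "t j" c P Q]) (use fin ann that in blast)+

  \<comment> \<open>If y = x or y = -x, no constancy assumption speaks about the pair (x, y). Then, however, c is
    supported on a single line, so that isolating one row of A \<times> B, which takes degree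
    card A - 1, is enough.\<close>
  have "c p q = 0" if p: "p \<in> A" and q: "q \<in> B" for p q
  proof (cases "x \<bullet> y = 1 \<or> x \<bullet> y = - 1")
    case True
    obtain \<sigma> :: real where y_eq: "y = \<sigma> *\<^sub>R x" "y' = \<sigma> *\<^sub>R x'" and cardAB: "card A = card B"
    proof (cases "x \<bullet> y = 1")
      case True
      then have "y = x" "y' = x'"
        using inner_eq_1_unit[of x y] inner_eq_1_unit[of x' y'] norms xy by auto
      moreover have "A = B"
        using \<open>y = x\<close> y design_family_mem_iff(1)[OF X ijk(1,3) x]
        by (simp add: A_def B_def angles_commute)
      ultimately show ?thesis using that[of 1] by simp
    next
      case False
      then have "y = - x" "y' = - x'"
        using \<open>x \<bullet> y = 1 \<or> x \<bullet> y = - 1\<close>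
          inner_eq_minus_1_unit[of x y] inner_eq_minus_1_unit[of x' y'] norms xy by auto
      moreover have "A = uminus ` B"
        using \<open>y = - x\<close> y design_family_mem_iff(2)[OF X ijk(1,3) x]
        by (simp add: A_def B_def angles_uminus_left angles_commute[of "X j"])
      then have "card A = card B" by (simp add: card_image)
      ultimately show ?thesis using that[of "- 1"] by simp
    qed
    have off: "c a b = 0" if "b \<noteq> \<sigma> * a" for a b
    proof -
      have "{z\<in>X j. x \<bullet> z = a \<and> y \<bullet> z = b} = {}" "{z\<in>Y j. x' \<bullet> z = a \<and> y' \<bullet> z = b} = {}"
        using that y_eq by auto
      then show ?thesis unfolding c_def pnum_def by (simp only:)
    qed
    \<comment> \<open>Since t j is positive, each of the three numerical alternatives with card B = card A
      implies this bound; the third uses that t j + 4 is even.\<close>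
    have "card A \<le> t j + 1"
      using triple t1 unfolding triple_condition_def s cardAB by (elim disjE conjE) presburger+
    show ?thesis
    proof (cases "q = \<sigma> * p")
      case True
      show ?thesis
      proof (rule last[of "{p}" B])
        fix a b assume "a \<in> {p}" "b \<in> B" "(a, b) \<noteq> (p, q)"
        then show "c a b = 0" using True by (intro off) auto
      qed (use p q \<open>card A \<le> t j + 1\<close> in auto)
    qed (rule off)
  next
    case False
    then have \<gamma>: "x \<bullet> y \<in> angles (X i) (X k)"
      using x y by (auto simp: angles_iff[OF Xi(3) Xk(3)])
    have known: "c a b = 0"
      if "\<exists>q. pnum_const (X i) (X j) (X k) (x \<bullet> y) a b q \<and> pnum_const (Y i) (Y j) (Y k) (x \<bullet> y) a b q"
      for a b
      using that x y x' y' xy by (auto simp: pnum_const_def c_def)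
    note data = same[unfolded same_data_def, THEN conjunct2, THEN conjunct2, rule_format, OF ijk,
        unfolded s, folded A_def B_def]
    consider (1) "int (card A) + int (card B) - 2 \<le> int (t j)"
      | (2) "int (card A) + int (card B) - 3 = int (t j)"
      | (3) "int (card A) + int (card B) - 4 = int (t j)"
      using triple unfolding triple_condition_def s by blast
    then show ?thesis
    proof cases
      case 1
      show ?thesis by (rule last[of "{p}" "{q}"]) (use 1 p q in auto)
    next
      case 2
      then obtain a b where ab: "a \<in> A" "b \<in> B" "c a b = 0"
        using data \<gamma> known by meson
      \<comment> \<open>The zero at (a, b) spreads along its row by pairs, and then from the row along each
        column.\<close>
      have row: "c a q = 0"
      proof (cases "q = b")
        case False
        show ?thesis
          by (rule last[of "{a}" "{b, q}"]) (use 2 ab q False in auto)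
      qed (use ab in simp)
      show ?thesis
      proof (cases "p = a")
        case False
        show ?thesis
          by (rule last[of "{a, p}" "{q}"]) (use 2 ab p q row False in auto)
      qed (use row in simp)
    next
      case 3
      then obtain a a' b b' where ab: "a \<in> A" "a' \<in> A" "b \<in> B" "b' \<in> B" "a \<noteq> a'" "b \<noteq> b'"
          and c0: "c a b = 0" "c a b' = 0" "c a' b = 0"
        using data \<gamma> known by meson
      \<comment> \<open>Two zeros in a row, or in a column, force the whole line to vanish; the remaining points
        are the fourth corners of rectangles whose other corners lie on these lines.\<close>
      have row: "c a q = 0"
      proof (cases "q = b \<or> q = b'")
        case False
        show ?thesis
          by (rule last[of "{a}" "{b, b', q}"]) (use 3 ab c0 q False in auto)
      qed (use c0 in auto)
      have column: "c p b = 0"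
      proof (cases "p = a \<or> p = a'")
        case False
        show ?thesis
          by (rule last[of "{a, a', p}" "{b}"]) (use 3 ab c0 p False in auto)
      qed (use c0 in auto)
      show ?thesis
      proof (cases "p = a \<or> q = b")
        case False
        show ?thesis
          by (rule last[of "{a, p}" "{b, q}"]) (use 3 ab c0 p q row column False in auto)
      qed (use row column in auto)
    qed
  qed
  then have "c a b = 0" using zero_left zero_right by blast
  then show ?thesis by (simp add: c_def)
qed

section \<open>Indices of relations and inner products\<close>

lemma angles'_eq:
  assumes "design_family n t X" "i \<in> {1..n}" "j \<in> {1..n}"
  shows "angles' (X i) (X j)
    = angles (X i) (X j) \<union> (if X i = uminus ` X j then {- 1} else {})"
proof -
  have unit: "x \<bullet> x = 1" if "x \<in> X i" for x
    using design_family_norm[OF assms(1,2) that] by (simp add: norm_eq_1)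
  have "- 1 \<in> angles' (X i) (X j)" if eq: "X i = uminus ` X j"
  proof -
    obtain x where x: "x \<in> X i" using design_familyD(2)[OF assms(1,2)] by blast
    then have "- x \<in> X j" using eq by auto
    moreover have inner: "x \<bullet> - x = - 1" using unit[OF x] by simp
    moreover have "x \<noteq> - x"
    proof
      assume "x = - x"
      then have "x \<bullet> x = x \<bullet> - x" by (rule arg_cong)
      then show False using unit[OF x] inner by simp
    qed
    ultimately show ?thesis using x unfolding angles'_def mem_Collect_eq
      by (intro exI[of _ x] exI[of _ "- x"]) simp
  qed
  moreover have "angles (X i) (X j) \<subseteq> angles' (X i) (X j)"
    unfolding angles_def angles'_def by blast
  moreover have "g \<in> angles (X i) (X j) \<or> g = - 1 \<and> X i = uminus ` X j"
    if mem: "g \<in> angles' (X i) (X j)" for g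
  proof -
    obtain x y where g: "g = x \<bullet> y" "x \<in> X i" "y \<in> X j" "x \<noteq> y"
      using mem unfolding angles'_def by blast
    show ?thesis
    proof (cases "x = - y")
      case True
      then show ?thesis
        using g unit[of x] design_family_mem_iff(2)[OF assms, of x] by auto
    next
      case False
      then show ?thesis using g unfolding angles_def by blast
    qed
  qed
  ultimately show ?thesis by - (rule set_eqI, split if_split, blast)
qed

definition inner_products :: "(real ^ 'd) set \<Rightarrow> (real ^ 'd) set \<Rightarrow> real set" where
  "inner_products X Y = {x \<bullet> y | x y. x \<in> X \<and> y \<in> Y}"

lemma inner_products_commute: "inner_products X Y = inner_products Y X"
proof -
  have "inner_products X Y \<subseteq> inner_products Y X" for X Y :: "(real ^ 'd) set"
    unfolding inner_products_def by clarify (metis inner_commute)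
  then show ?thesis by blast
qed

lemma inner_products_eq:
  assumes "design_family n t X" "i \<in> {1..n}" "j \<in> {1..n}"
  shows "inner_products (X i) (X j) = (if X i = X j then {1} else {}) \<union> angles' (X i) (X j)"
proof -
  have unit: "x \<bullet> x = 1" if "x \<in> X i" for x
    using design_family_norm[OF assms(1,2) that] by (simp add: norm_eq_1)
  have "1 \<in> inner_products (X i) (X j)" if "X i = X j"
    using that design_familyD(2)[OF assms(1,2)] unit unfolding inner_products_def by force
  moreover have "angles' (X i) (X j) \<subseteq> inner_products (X i) (X j)"
    unfolding inner_products_def angles'_def by blast
  moreover have "g \<in> angles' (X i) (X j) \<or> g = 1 \<and> X i = X j"
    if mem: "g \<in> inner_products (X i) (X j)" for g
  proof -
    obtain x y where g: "g = x \<bullet> y" "x \<in> X i" "y \<in> X j"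
      using mem unfolding inner_products_def by blast
    show ?thesis
    proof (cases "x = y")
      case True
      then show ?thesis
        using g unit[of x] design_family_mem_iff(1)[OF assms, of x] by auto
    next
      case False
      then show ?thesis using g unfolding angles'_def by blast
    qed
  qed
  ultimately show ?thesis by - (rule set_eqI, split if_split, blast)
qed

text \<open>
  The index \<open>0\<close> is present exactly if \<open>X i = X j\<close>, that is, if the inner product \<open>1\<close> occurs; the index
  \<open>num_angles X i j + 1\<close> is present exactly if \<open>X i = uminus ` X j\<close>, that is, if \<open>- 1\<close> occurs.
  Hence indices correspond to the occurring inner products without repetition.
\<close>

lemma bij_betw_indices_inner_products:
  assumes X: "design_family n t X" and \<alpha>: "angle_enumeration n X \<alpha>"
    and ij: "i \<in> {1..n}" "j \<in> {1..n}"
  shows "bij_betw (\<alpha> i j) {k. (i, j, k) \<in> rel_indices n X} (inner_products (X i) (X j))"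
proof -
  let ?A = "angles (X i) (X j)" and ?A' = "angles' (X i) (X j)"
  have bij: "bij_betw (\<alpha> i j) {1..card ?A} ?A" and at0: "\<alpha> i j 0 = 1"
    and last: "- 1 \<in> ?A' \<Longrightarrow> \<alpha> i j (card ?A') = - 1"
    using \<alpha> ij unfolding angle_enumeration_def num_angles_def by auto
  have no: "1 \<notin> ?A" "- 1 \<notin> ?A"
    using angles_iff[OF design_familyD(3)[OF X ij(1)] design_familyD(3)[OF X ij(2)]] by auto
  have fin: "finite ?A"
    using design_familyD(1)[OF X] ij by (intro finite_angles) auto
  have bij': "bij_betw (\<alpha> i j) {1..card ?A'} ?A'"
  proof (cases "X i = uminus ` X j")
    case True
    then have A': "?A' = ?A \<union> {- 1}" using angles'_eq[OF X ij] by simp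
    then have card: "card ?A' = Suc (card ?A)" using fin no by simp
    have "bij_betw (\<alpha> i j) {card ?A'} {- 1}"
      using last A' by (simp add: bij_betw_def)
    with bij have "bij_betw (\<alpha> i j) ({1..card ?A} \<union> {card ?A'}) (?A \<union> {- 1})"
      using no by (intro bij_betw_combine) auto
    moreover have "{1..card ?A} \<union> {card ?A'} = {1..card ?A'}" using card by auto
    ultimately show ?thesis using A' by simp
  next
    case False
    then show ?thesis using bij angles'_eq[OF X ij] by simp
  qed
  show ?thesis
  proof (cases "X i = X j")
    case True
    have "1 \<notin> ?A'" using angles'_eq[OF X ij] no by auto
    moreover have "bij_betw (\<alpha> i j) {0} {1}" using at0 by (simp add: bij_betw_def)
    ultimately have "bij_betw (\<alpha> i j) ({0} \<union> {1..card ?A'}) ({1} \<union> ?A')"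
      using bij' by (intro bij_betw_combine) auto
    moreover have "{k. (i, j, k) \<in> rel_indices n X} = {0} \<union> {1..card ?A'}"
      using ij True by (auto simp: rel_indices_def)
    ultimately show ?thesis using inner_products_eq[OF X ij] True by simp
  next
    case False
    moreover have "{k. (i, j, k) \<in> rel_indices n X} = {1..card ?A'}"
      using ij False by (auto simp: rel_indices_def)
    ultimately show ?thesis using bij' inner_products_eq[OF X ij] by simp
  qed
qed

section \<open>The coherent configuration and its parameters\<close>

lemma mem_rels:
  "((u, x), (v, y)) \<in> rels X \<alpha> (i, j, k)
    \<longleftrightarrow> u = i \<and> v = j \<and> x \<in> X i \<and> y \<in> X j \<and> x \<bullet> y = \<alpha> i j k"
  by (auto simp: rels_def)

lemma rels_nonempty:
  assumes "design_family n t X" "angle_enumeration n X \<alpha>" "p \<in> rel_indices n X"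
  shows "rels X \<alpha> p \<noteq> {}"
proof -
  obtain i j k where p: "p = (i, j, k)" by (cases p)
  then have "i \<in> {1..n}" "j \<in> {1..n}" using assms(3) by (auto simp: rel_indices_def)
  from bij_betw_indices_inner_products[OF assms(1,2) this] p assms(3)
  have "\<alpha> i j k \<in> inner_products (X i) (X j)" by (auto simp: bij_betw_def)
  then obtain x y where "x \<in> X i" "y \<in> X j" "\<alpha> i j k = x \<bullet> y"
    unfolding inner_products_def by blast
  then have "((i, x), (j, y)) \<in> rels X \<alpha> p" by (simp add: p mem_rels)
  then show ?thesis by blast
qed

lemma ex1_rel:
  assumes X: "design_family n t X" and \<alpha>: "angle_enumeration n X \<alpha>"
    and "e \<in> points n X \<times> points n X"
  shows "\<exists>!p. p \<in> rel_indices n X \<and> e \<in> rels X \<alpha> p"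
proof -
  obtain i x j y where e: "e = ((i, x), (j, y))" by (metis surj_pair)
  then have ij: "i \<in> {1..n}" "j \<in> {1..n}" and xy: "x \<in> X i" "y \<in> X j"
    using assms(3) by (auto simp: points_def)
  note bij = bij_betw_indices_inner_products[OF X \<alpha> ij]
  have "x \<bullet> y \<in> inner_products (X i) (X j)"
    using xy unfolding inner_products_def by blast
  then have "x \<bullet> y \<in> \<alpha> i j ` {k. (i, j, k) \<in> rel_indices n X}"
    using bij by (simp add: bij_betw_def)
  then obtain k where k: "(i, j, k) \<in> rel_indices n X" "\<alpha> i j k = x \<bullet> y"
    by auto
  show ?thesis
  proof (rule ex1I[of _ "(i, j, k)"])
    show "(i, j, k) \<in> rel_indices n X \<and> e \<in> rels X \<alpha> (i, j, k)"
      using k xy by (simp add: e mem_rels)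
  next
    fix p assume p: "p \<in> rel_indices n X \<and> e \<in> rels X \<alpha> p"
    then obtain k' where k': "p = (i, j, k')" "\<alpha> i j k' = x \<bullet> y"
      by (cases p) (auto simp: e mem_rels)
    then have "k' = k"
      using p k inj_onD[OF bij_betw_imp_inj_on[OF bij], of k' k] by simp
    then show "p = (i, j, k)" using k' by simp
  qed
qed

lemma card_paths:
  assumes "j \<in> {1..n}" "x \<in> X i" "y \<in> X l"
  shows "card {z\<in>points n X. ((u, x), z) \<in> rels X \<alpha> (i, j, k) \<and> (z, (v, y)) \<in> rels X \<alpha> (j', l, m)}
    = (if u = i \<and> v = l \<and> j = j' then pnum (X j) (\<alpha> i j k) (\<alpha> j l m) x y else 0)"
proof -
  have "{z\<in>points n X. ((u, x), z) \<in> rels X \<alpha> (i, j, k) \<and> (z, (v, y)) \<in> rels X \<alpha> (j', l, m)}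
    = (if u = i \<and> v = l \<and> j = j'
       then Pair j ` {z\<in>X j. x \<bullet> z = \<alpha> i j k \<and> y \<bullet> z = \<alpha> j l m} else {})"
    using assms by (auto simp: points_def mem_rels inner_commute)
  then show ?thesis by (simp add: pnum_def card_image inj_on_def)
qed

lemma card_paths_eq:
  assumes X: "design_family n t X" and Y: "design_family n t Y" and same: "same_data n t X Y"
    and triple: "\<forall>i\<in>{1..n}. \<forall>j\<in>{1..n}. \<forall>k\<in>{1..n}. triple_condition t X i j k"
    and p: "p \<in> rel_indices n X" and r: "r \<in> rel_indices n X"
    and e: "(v, w) \<in> rels X \<alpha> r" and e': "(v', w') \<in> rels Y \<alpha> r"
  shows "card {z\<in>points n X. (v, z) \<in> rels X \<alpha> p \<and> (z, w) \<in> rels X \<alpha> q}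
       = card {z\<in>points n Y. (v', z) \<in> rels Y \<alpha> p \<and> (z, w') \<in> rels Y \<alpha> q}"
proof -
  obtain i j k where p_eq: "p = (i, j, k)" by (cases p)
  obtain j' l m where q_eq: "q = (j', l, m)" by (cases q)
  obtain i0 l0 h where r_eq: "r = (i0, l0, h)" by (cases r)
  have ind: "j \<in> {1..n}" "i0 \<in> {1..n}" "l0 \<in> {1..n}"
    using p r by (auto simp: p_eq r_eq rel_indices_def)
  obtain x y where vw: "v = (i0, x)" "w = (l0, y)"
    and xy: "x \<in> X i0" "y \<in> X l0" "x \<bullet> y = \<alpha> i0 l0 h"
    using e by (cases v; cases w) (auto simp: r_eq mem_rels)
  obtain x' y' where vw': "v' = (i0, x')" "w' = (l0, y')"
    and xy': "x' \<in> Y i0" "y' \<in> Y l0" "x' \<bullet> y' = \<alpha> i0 l0 h"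
    using e' by (cases v'; cases w') (auto simp: r_eq mem_rels)
  show ?thesis
  proof (cases "i = i0 \<and> l = l0")
    case True
    have "pnum (X j) a b x y = pnum (Y j) a b x' y'" for a b
      using xy xy' triple ind
      by (intro pnum_eq[OF X Y same _ ind(2,1,3)]) auto
    with True show ?thesis
      using xy xy' ind by (auto simp: p_eq q_eq vw vw' card_paths)
  next
    case False
    then have "{z\<in>points n X. (v, z) \<in> rels X \<alpha> p \<and> (z, w) \<in> rels X \<alpha> q} = {}"
      "{z\<in>points n Y. (v', z) \<in> rels Y \<alpha> p \<and> (z, w') \<in> rels Y \<alpha> q} = {}"
      by (auto simp: p_eq q_eq vw vw' mem_rels)
    then show ?thesis by (simp only:)
  qed
qed

text \<open>
  Not a mere reflexivity: the three alternatives exclude each other numerically, so an equality in the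
  data clauses singles out the alternative that provides the required constants.
\<close>

lemma same_data_refl:
  assumes "\<forall>i\<in>{1..n}. \<forall>j\<in>{1..n}. \<forall>k\<in>{1..n}. triple_condition t X i j k"
  shows "same_data n t X X"
proof -
  have "(int (num_angles X i j) + int (num_angles X j k) - 3 = int (t j) \<longrightarrow>
          (\<forall>\<gamma>\<in>angles (X i) (X k). \<exists>a\<in>angles (X i) (X j). \<exists>b\<in>angles (X j) (X k).
             \<exists>q. pnum_const (X i) (X j) (X k) \<gamma> a b q)) \<and>
        (int (num_angles X i j) + int (num_angles X j k) - 4 = int (t j) \<longrightarrow>
          (\<forall>\<gamma>\<in>angles (X i) (X k). \<exists>a\<in>angles (X i) (X j). \<exists>a'\<in>angles (X i) (X j).
             \<exists>b\<in>angles (X j) (X k). \<exists>b'\<in>angles (X j) (X k). a \<noteq> a' \<and> b \<noteq> b' \<and>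
             (\<exists>q. pnum_const (X i) (X j) (X k) \<gamma> a b q) \<and>
             (\<exists>q. pnum_const (X i) (X j) (X k) \<gamma> a b' q) \<and>
             (\<exists>q. pnum_const (X i) (X j) (X k) \<gamma> a' b q)))"
    if "triple_condition t X i j k" for i j k
    using that unfolding triple_condition_def
    by (elim disjE conjE; intro conjI impI) (assumption | linarith)+
  then show ?thesis using assms unfolding same_data_def by simp
qed

lemma same_data_angles':
  assumes X: "design_family n t X" and Y: "design_family n t Y" and same: "same_data n t X Y"
    and ij: "i \<in> {1..n}" "j \<in> {1..n}"
  shows "angles' (Y i) (Y j) = angles' (X i) (X j)"
  using same ij unfolding same_data_def by (simp add: angles'_eq[OF X ij] angles'_eq[OF Y ij])

lemma same_data_rel_indices:
  assumes "design_family n t X" "design_family n t Y" "same_data n t X Y"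
  shows "rel_indices n Y = rel_indices n X"
proof -
  have "X i = X j \<longleftrightarrow> Y i = Y j" if "i \<in> {1..n}" "j \<in> {1..n}" for i j
    using assms(3) that unfolding same_data_def by simp
  then show ?thesis
    using same_data_angles'[OF assms] unfolding rel_indices_def by auto
qed

lemma same_data_angle_enumeration:
  assumes "design_family n t X" "design_family n t Y" "same_data n t X Y"
    and "angle_enumeration n X \<alpha>"
  shows "angle_enumeration n Y \<alpha>"
proof -
  have "angles (Y i) (Y j) = angles (X i) (X j)" if "i \<in> {1..n}" "j \<in> {1..n}" for i j
    using assms(3) that unfolding same_data_def by simp
  then show ?thesis
    using assms(4) same_data_angles'[OF assms(1-3)]
    unfolding angle_enumeration_def num_angles_def by simp
qed

lemma coherent_configuration_design_family:
  assumes X: "design_family n t X" and \<alpha>: "angle_enumeration n X \<alpha>"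
    and triple: "\<forall>i\<in>{1..n}. \<forall>j\<in>{1..n}. \<forall>k\<in>{1..n}. triple_condition t X i j k"
  shows "coherent_configuration (points n X) (rel_indices n X) (rels X \<alpha>)"
  unfolding coherent_configuration_def
proof (intro conjI ballI)
  let ?P = "points n X" and ?I = "rel_indices n X" and ?R = "rels X \<alpha>"
  show "finite ?P"
    using design_familyD(1)[OF X] unfolding points_def by (intro finite_SigmaI) auto
  have sub: "?R p \<subseteq> ?P \<times> ?P" if "p \<in> ?I" for p
    using that by (cases p) (auto simp: rels_def points_def rel_indices_def)
  have uniq: "p = q" if "p \<in> ?I" "q \<in> ?I" "e \<in> ?R p" "e \<in> ?R q" for p q e
    using that ex1_rel[OF X \<alpha>, of e] sub by blast
  show "partition_on (?P \<times> ?P) (?R ` ?I)"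
  proof (rule partition_onI)
    show "\<Union> (?R ` ?I) = ?P \<times> ?P"
      using sub ex1_rel[OF X \<alpha>] by blast
    show "{} \<notin> ?R ` ?I" using rels_nonempty[OF X \<alpha>] by (metis imageE)
    show "disjnt E F" if "E \<in> ?R ` ?I" "F \<in> ?R ` ?I" "E \<noteq> F" for E F
      using that uniq unfolding disjnt_def by blast
  qed
  show "inj_on ?R ?I"
  proof (rule inj_onI)
    fix p q assume pq: "p \<in> ?I" "q \<in> ?I" "?R p = ?R q"
    obtain e where "e \<in> ?R p" using rels_nonempty[OF X \<alpha> pq(1)] by blast
    then show "p = q" using uniq pq by blast
  qed
  fix p assume p: "p \<in> ?I"
  obtain i j k where p_eq: "p = (i, j, k)" by (cases p)
  have ij: "i \<in> {1..n}" "j \<in> {1..n}" using p by (auto simp: p_eq rel_indices_def)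
  show "\<exists>p'\<in>?I. (?R p)\<inverse> = ?R p'"
  proof -
    have "\<alpha> i j k \<in> inner_products (X i) (X j)"
      using bij_betw_indices_inner_products[OF X \<alpha> ij] p by (auto simp: p_eq bij_betw_def)
    then have "\<alpha> i j k \<in> inner_products (X j) (X i)"
      by (simp add: inner_products_commute)
    then have "\<alpha> i j k \<in> \<alpha> j i ` {k. (j, i, k) \<in> ?I}"
      using bij_betw_indices_inner_products[OF X \<alpha> ij(2,1)] by (simp add: bij_betw_def)
    then obtain k' where k': "(j, i, k') \<in> ?I" "\<alpha> j i k' = \<alpha> i j k"
      by auto
    then have "(?R p)\<inverse> = ?R (j, i, k')"
      by (auto simp: p_eq rels_def inner_commute)
    with k' show ?thesis by blast
  qed
  show "?R p \<inter> Id_on ?P \<noteq> {} \<longrightarrow> ?R p \<subseteq> Id_on ?P"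
  proof
    assume "?R p \<inter> Id_on ?P \<noteq> {}"
    then obtain x where x: "i = j" "x \<in> X i" "x \<bullet> x = \<alpha> i j k"
      by (auto simp: p_eq mem_rels)
    then have "\<alpha> i j k = 1"
      using design_family_norm[OF X ij(1)] by (simp add: norm_eq_1)
    then have "\<forall>y\<in>X i. \<forall>z\<in>X i. y \<bullet> z = \<alpha> i j k \<longrightarrow> y = z"
      using inner_eq_1_unit design_family_norm[OF X ij(1)] by metis
    then show "?R p \<subseteq> Id_on ?P"
      using x(1) ij by (fastforce simp: p_eq rels_def points_def Id_on_def)
  qed
  fix q r assume q: "q \<in> ?I" and r: "r \<in> ?I"
  obtain v w where "(v, w) \<in> ?R r" using rels_nonempty[OF X \<alpha> r] by (metis ex_in_conv surj_pair)
  from card_paths_eq[OF X X same_data_refl[OF triple] triple p r _ this, of _ _ q]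
  show "\<exists>c. \<forall>(x, y)\<in>?R r. card {z\<in>?P. (x, z) \<in> ?R p \<and> (z, y) \<in> ?R q} = c"
    by blast
qed

theorem theorem2p6:
  fixes n :: nat
    and t :: "nat \<Rightarrow> nat"
    and X :: "nat \<Rightarrow> (real ^ 'd) set"
    and \<alpha> :: "nat \<Rightarrow> nat \<Rightarrow> nat \<Rightarrow> real"
  assumes "design_family n t X"
    and "angle_enumeration n X \<alpha>"
    and "\<forall>i\<in>{1..n}. \<forall>j\<in>{1..n}. \<forall>k\<in>{1..n}. triple_condition t X i j k"
  shows "coherent_configuration (points n X) (rel_indices n X) (rels X \<alpha>) \<and>
    (\<forall>Y :: nat \<Rightarrow> (real ^ 'd) set.
       design_family n t Y \<longrightarrow>
       (\<forall>i\<in>{1..n}. \<forall>j\<in>{1..n}. \<forall>k\<in>{1..n}. triple_condition t Y i j k) \<longrightarrow>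
       same_data n t X Y \<longrightarrow>
       rel_indices n Y = rel_indices n X \<and>
       (\<forall>p\<in>rel_indices n X. \<forall>q\<in>rel_indices n X. \<forall>r\<in>rel_indices n X.
          intersection_number (points n Y) (rels Y \<alpha>) p q r
            = intersection_number (points n X) (rels X \<alpha>) p q r))"
proof (intro conjI allI impI ballI)
  show "coherent_configuration (points n X) (rel_indices n X) (rels X \<alpha>)"
    using assms by (rule coherent_configuration_design_family)
next
  fix Y :: "nat \<Rightarrow> (real ^ 'd) set"
  assume Y: "design_family n t Y" and same: "same_data n t X Y"
  show I: "rel_indices n Y = rel_indices n X"
    using assms(1) Y same by (rule same_data_rel_indices)
  fix p q r
  assume p: "p \<in> rel_indices n X" and "q \<in> rel_indices n X" and r: "r \<in> rel_indices n X"
  have \<alpha>Y: "angle_enumeration n Y \<alpha>"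
    using assms(1) Y same assms(2) by (rule same_data_angle_enumeration)
  let ?cX = "\<lambda>x y. card {z\<in>points n X. (x, z) \<in> rels X \<alpha> p \<and> (z, y) \<in> rels X \<alpha> q}"
  let ?cY = "\<lambda>x y. card {z\<in>points n Y. (x, z) \<in> rels Y \<alpha> p \<and> (z, y) \<in> rels Y \<alpha> q}"
  obtain x y where xy: "(x, y) \<in> rels X \<alpha> r"
    using rels_nonempty[OF assms(1,2) r] by (metis ex_in_conv surj_pair)
  obtain x' y' where xy': "(x', y') \<in> rels Y \<alpha> r"
    using rels_nonempty[OF Y \<alpha>Y] r I by (metis ex_in_conv surj_pair)
  have eq: "?cX u v = ?cY u' v'" if "(u, v) \<in> rels X \<alpha> r" "(u', v') \<in> rels Y \<alpha> r" for u v u' v'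
    using card_paths_eq[OF assms(1) Y same assms(3) p r that] .
  have "(\<forall>(u, v)\<in>rels Y \<alpha> r. ?cY u v = c) \<longleftrightarrow> (\<forall>(u, v)\<in>rels X \<alpha> r. ?cX u v = c)" for c
    using eq xy xy' by fastforce
  then show "intersection_number (points n Y) (rels Y \<alpha>) p q r
      = intersection_number (points n X) (rels X \<alpha>) p q r"
    by (simp add: intersection_number_def)
qed

end
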